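(* Let $q \in \mathbb{Q}_{>0}$, and let $M_q$ be the underlying additive monoid of $\mathbb{N}_0[q]$. Then the following conditions are equivalent. (a) $M_q$ is a length-finite factorization monoid (LFFM). (b) $M_q$ is atomic. (c) $q \in \mathbb{Q} \setminus \{\frac1n : n \in \mathbb{N},\ n \ge 2\}$.
   Context: For $q \in \mathbb{Q}_{>0}$, $\mathbb{N}_0[q] = \{f(q) : f(x) \in \mathbb{N}_0[x]\}$, whose underlying additive monoid is $M_q = \langle q^n : n \in \mathbb{N}_0\rangle \subseteq \mathbb{Q}_{\ge 0}$. An atom of $M_q$ is an element $a \in M_q \setminus \{0\}$ such that $a = b+c$ with $b,c \in M_q$ implies $b=0$ or $c=0$. $M_q$ is atomic if every nonzero element is a finite sum of atoms (repetitions allowed). For an atomic submonoid $M$ of $(\mathbb{Q}_{\ge 0},+)$, a factorization of $b \in M$ is a finite formal sum (multiset) of atoms of $M$ whose sum in $M$ is $b$; its length is the number of atoms counted with multiplicity. $M$ is an LFFM if it is atomic and for every $b \in M$ and $\ell \in \mathbb{N}_0$ the element $b$ has only finitely many factorizations of length $\ell$. *)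

theory Defs
  imports Complex_Main "HOL-Library.Multiset" "HOL-Computational_Algebra.Polynomial"
begin

text \<open>
  Submonoids of the additive monoid of nonnegative rationals are represented by their carriers,
  as sets of rationals.
\<close>

definition nat_eval_semiring :: "rat \<Rightarrow> rat set" where
  "nat_eval_semiring q = {poly (map_poly of_nat f) q | f :: nat poly. True}"

definition add_submonoid :: "rat set \<Rightarrow> bool" where
  "add_submonoid M \<longleftrightarrow> M \<subseteq> {0..} \<and> 0 \<in> M \<and> (\<forall>x\<in>M. \<forall>y\<in>M. x + y \<in> M)"

definition add_atoms :: "rat set \<Rightarrow> rat set" where
  "add_atoms M = {a \<in> M - {0}. \<forall>b\<in>M. \<forall>c\<in>M. a = b + c \<longrightarrow> b = 0 \<or> c = 0}"

definition atomic_monoid :: "rat set \<Rightarrow> bool" where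
  "atomic_monoid M \<longleftrightarrow>
     (\<forall>b \<in> M - {0}. \<exists>F :: rat multiset. set_mset F \<subseteq> add_atoms M \<and> sum_mset F = b)"

definition factorizations :: "rat set \<Rightarrow> rat \<Rightarrow> rat multiset set" where
  "factorizations M b = {F. set_mset F \<subseteq> add_atoms M \<and> sum_mset F = b}"

definition LFFM :: "rat set \<Rightarrow> bool" where
  "LFFM M \<longleftrightarrow>
     atomic_monoid M \<and> (\<forall>b\<in>M. \<forall>l::nat. finite {F \<in> factorizations M b. size F = l})"

text \<open>
  The evaluation semiring is, additively, the submonoid generated by the powers of \<open>q\<close>.
\<close>

lemma add_submonoid_nat_eval_semiring:
  assumes "q > 0"
  shows "add_submonoid (nat_eval_semiring q)"
  unfolding add_submonoid_def
proof (intro conjI ballI)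
  show "nat_eval_semiring q \<subseteq> {0..}"
    using assms by (auto simp: nat_eval_semiring_def poly_altdef coeff_map_poly intro!: sum_nonneg)
  show "0 \<in> nat_eval_semiring q"
    unfolding nat_eval_semiring_def by (rule CollectI, rule exI[of _ 0]) simp
next
  fix x y assume "x \<in> nat_eval_semiring q" "y \<in> nat_eval_semiring q"
  then obtain f g :: "nat poly" where
    "x = poly (map_poly of_nat f) q" "y = poly (map_poly of_nat g) q"
    unfolding nat_eval_semiring_def by blast
  moreover have "map_poly of_nat (f + g) = (map_poly of_nat f + map_poly of_nat g :: rat poly)"
    by (rule poly_eqI) (simp add: coeff_map_poly)
  ultimately show "x + y \<in> nat_eval_semiring q"
    unfolding nat_eval_semiring_def by (intro CollectI exI[of _ "f + g"]) simp
qed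

lemma nat_eval_semiring_eq_generated:
  assumes "q > 0"
  shows "nat_eval_semiring q = \<Inter>{M. add_submonoid M \<and> (\<forall>n. q ^ n \<in> M)}"
proof
  have "q ^ n \<in> nat_eval_semiring q" for n
    unfolding nat_eval_semiring_def
    by (rule CollectI, rule exI[of _ "monom 1 n"]) (simp add: map_poly_monom poly_monom)
  then show "\<Inter>{M. add_submonoid M \<and> (\<forall>n. q ^ n \<in> M)} \<subseteq> nat_eval_semiring q"
    using add_submonoid_nat_eval_semiring[OF assms] by blast
  show "nat_eval_semiring q \<subseteq> \<Inter>{M. add_submonoid M \<and> (\<forall>n. q ^ n \<in> M)}"
  proof (intro subsetI InterI)
    fix x M assume x: "x \<in> nat_eval_semiring q" and "M \<in> {M. add_submonoid M \<and> (\<forall>n. q ^ n \<in> M)}"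
    then have M: "0 \<in> M" "\<And>x y. x \<in> M \<Longrightarrow> y \<in> M \<Longrightarrow> x + y \<in> M" "\<And>n. q ^ n \<in> M"
      by (auto simp: add_submonoid_def)
    have mult: "of_nat k * q ^ n \<in> M" for k n
      by (induction k) (use M in \<open>auto simp: algebra_simps\<close>)
    have sum: "(\<Sum>i\<in>A. of_nat (c i) * q ^ i) \<in> M" if "finite A" for A and c :: "nat \<Rightarrow> nat"
      using that by (induction A) (use M mult in auto)
    from x show "x \<in> M"
      by (auto simp: nat_eval_semiring_def poly_altdef coeff_map_poly intro!: sum)
  qed
qed

end

theory Submission
  imports Defs
begin

text \<open>
  Every atom of \<open>M\<^sub>q\<close> is a power of \<open>q\<close>. A factorization of \<open>x\<close> of length \<open>l\<close> contains an atom in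
  \<open>[x / l, x]\<close>, and only finitely many powers of \<open>q\<close> lie there; removing such an atom and inducting
  on \<open>l\<close> shows that atomicity already implies LFFM. If \<open>q \<ge> 1\<close>, all nonzero elements are at least
  1, so splitting an element into nonzero summands terminates. If \<open>q = a / b < 1\<close> in lowest terms
  with \<open>a \<ge> 2\<close>, every \<open>q ^ k\<close> is an atom: a nontrivial decomposition only involves higher powers of
  \<open>q\<close>, and clearing denominators yields \<open>a dvd b ^ N\<close>. If \<open>q = 1 / n\<close> with \<open>n \<ge> 2\<close>, then
  \<open>q ^ k = n q ^ (k + 1)\<close> shows that there are no atoms.
\<close>

section \<open>Elements and atoms as sums of powers of \<open>q\<close>\<close>

lemma nat_eval_semiring_closed:
  assumes "q > 0"
  shows power_in_nat_eval_semiring: "q ^ n \<in> nat_eval_semiring q"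
    and add_in_nat_eval_semiring:
      "x \<in> nat_eval_semiring q \<Longrightarrow> y \<in> nat_eval_semiring q \<Longrightarrow> x + y \<in> nat_eval_semiring q"
    and zero_in_nat_eval_semiring: "0 \<in> nat_eval_semiring q"
    and nat_eval_semiring_nonneg: "x \<in> nat_eval_semiring q \<Longrightarrow> x \<ge> 0"
proof -
  show "q ^ n \<in> nat_eval_semiring q"
    unfolding nat_eval_semiring_eq_generated[OF assms] by blast
qed (use add_submonoid_nat_eval_semiring[OF assms] in \<open>auto simp: add_submonoid_def\<close>)

text \<open>A multiset of exponents encodes a polynomial, multiplicities being coefficients; this
  form permits induction on one power at a time. The sums form a submonoid containing all powers, so
  minimality gives the harder inclusion.\<close>

lemma nat_eval_semiring_eq_sum_powers:
  assumes "q > 0"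
  shows "nat_eval_semiring q = range (\<lambda>ns. \<Sum>n\<in>#ns. q ^ n)"
proof
  show "range (\<lambda>ns. \<Sum>n\<in>#ns. q ^ n) \<subseteq> nat_eval_semiring q"
  proof safe
    fix ns :: "nat multiset"
    show "(\<Sum>n\<in>#ns. q ^ n) \<in> nat_eval_semiring q"
      by (induction ns) (auto intro: nat_eval_semiring_closed[OF assms])
  qed
  have nonneg: "(\<Sum>n\<in>#ns. q ^ n) \<ge> 0" for ns
    using assms by (induction ns) auto
  have "add_submonoid (range (\<lambda>ns. \<Sum>n\<in>#ns. q ^ n))"
    unfolding add_submonoid_def
  proof (intro conjI ballI)
    show "0 \<in> range (\<lambda>ns. \<Sum>n\<in>#ns. q ^ n)"
      by (rule range_eqI[of _ _ "{#}"]) simp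
  next
    fix x y assume "x \<in> range (\<lambda>ns. \<Sum>n\<in>#ns. q ^ n)" "y \<in> range (\<lambda>ns. \<Sum>n\<in>#ns. q ^ n)"
    then obtain ms ns where "x = (\<Sum>n\<in>#ms. q ^ n)" "y = (\<Sum>n\<in>#ns. q ^ n)" by blast
    then show "x + y \<in> range (\<lambda>ns. \<Sum>n\<in>#ns. q ^ n)"
      by (intro range_eqI[of _ _ "ms + ns"]) simp
  qed (use nonneg in auto)
  moreover have "q ^ n \<in> range (\<lambda>ns. \<Sum>n\<in>#ns. q ^ n)" for n
    by (rule range_eqI[of _ _ "{#n#}"]) simp
  ultimately show "nat_eval_semiring q \<subseteq> range (\<lambda>ns. \<Sum>n\<in>#ns. q ^ n)"
    unfolding nat_eval_semiring_eq_generated[OF assms] by blast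
qed

text \<open>Splitting one power off a representation of an atom forces the remaining sum to vanish,
  since the power is positive.\<close>

lemma add_atoms_subset_powers:
  assumes "q > 0"
  shows "add_atoms (nat_eval_semiring q) \<subseteq> range (\<lambda>n. q ^ n)"
proof
  fix a assume a: "a \<in> add_atoms (nat_eval_semiring q)"
  then obtain ns where ns: "a = (\<Sum>n\<in>#ns. q ^ n)" "a \<noteq> 0"
    by (auto simp: add_atoms_def nat_eval_semiring_eq_sum_powers[OF assms])
  then obtain n ms where "ns = add_mset n ms" by (cases ns) auto
  with ns have eq: "a = q ^ n + (\<Sum>n\<in>#ms. q ^ n)" by simp
  moreover have "(\<Sum>n\<in>#ms. q ^ n) \<in> nat_eval_semiring q"
    by (simp add: nat_eval_semiring_eq_sum_powers[OF assms])
  ultimately have "q ^ n = 0 \<or> (\<Sum>n\<in>#ms. q ^ n) = 0"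
    using a power_in_nat_eval_semiring[OF assms, of n] unfolding add_atoms_def by blast
  with eq assms show "a \<in> range (\<lambda>n. q ^ n)" by auto
qed

section \<open>Finiteness of the factorizations of a given length\<close>

lemma finite_powers_Icc:
  fixes q c d :: rat
  assumes "q > 0" "c > 0"
  shows "finite (range (\<lambda>n::nat. q ^ n) \<inter> {c..d})"
proof (cases q "1 :: rat" rule: linorder_cases)
  case less
  then obtain N where N: "q ^ N < c"
    using real_arch_pow_inv[of "of_rat c" "of_rat q"] assms
    by (auto simp: of_rat_less simp flip: of_rat_power)
  have "range (\<lambda>n::nat. q ^ n) \<inter> {c..d} \<subseteq> (\<lambda>n. q ^ n) ` {..N}"
  proof safe
    fix n assume "q ^ n \<in> {c..d}"
    moreover have "q ^ n \<le> q ^ N" if "n > N"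
      using that less assms by (intro power_decreasing) auto
    ultimately show "q ^ n \<in> (\<lambda>n. q ^ n) ` {..N}"
      using N by (intro imageI) (force simp: not_le[symmetric])
  qed
  then show ?thesis by (rule finite_subset) simp
next
  case equal
  then have "range (\<lambda>n::nat. q ^ n) \<inter> {c..d} \<subseteq> {1}" by auto
  then show ?thesis by (rule finite_subset) simp
next
  case greater
  then obtain N where N: "d < q ^ N"
    using real_arch_pow[of "of_rat q" "of_rat d"] by (auto simp: of_rat_less simp flip: of_rat_power)
  have "range (\<lambda>n::nat. q ^ n) \<inter> {c..d} \<subseteq> (\<lambda>n. q ^ n) ` {..N}"
  proof safe
    fix n assume "q ^ n \<in> {c..d}"
    moreover have "q ^ N \<le> q ^ n" if "n > N"
      using that greater by (intro power_increasing) auto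
    ultimately show "q ^ n \<in> (\<lambda>n. q ^ n) ` {..N}"
      using N by (intro imageI) (force simp: not_le[symmetric])
  qed
  then show ?thesis by (rule finite_subset) simp
qed

lemma sum_mset_le_size_mult:
  fixes F :: "'a :: linordered_idom multiset"
  assumes "\<And>a. a \<in># F \<Longrightarrow> a \<le> c"
  shows "sum_mset F \<le> of_nat (size F) * c"
  using assms
proof (induction F)
  case (add a F)
  have "sum_mset F \<le> of_nat (size F) * c" "a \<le> c" using add by auto
  then show ?case by (simp add: algebra_simps)
qed simp

text \<open>The set \<open>A\<close> may be infinite near 0, as the powers of \<open>q\<close> are
  for \<open>q < 1\<close>; hence \<open>fin\<close> only concerns \<open>c > 0\<close>. The sum
  \<open>x\<close> varies in the induction because removing \<open>a\<close> leaves
  \<open>x - a\<close>.\<close>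

lemma finite_fixed_size_mset_sum:
  fixes A :: "'a :: linordered_field set"
  assumes pos: "\<And>a. a \<in> A \<Longrightarrow> a > 0"
    and fin: "\<And>c d. c > 0 \<Longrightarrow> finite (A \<inter> {c..d})"
  shows "finite {F. set_mset F \<subseteq> A \<and> sum_mset F = x \<and> size F = l}"
proof (induction l arbitrary: x)
  case 0
  have "{F. set_mset F \<subseteq> A \<and> sum_mset F = x \<and> size F = 0} \<subseteq> {{#}}" by auto
  then show ?case by (rule finite_subset) simp
next
  case (Suc l)
  \<comment> \<open>The mean of \<open>Suc l\<close> elements with sum \<open>x\<close>; some
    element must reach it.\<close>
  define c where "c = x / of_nat (Suc l)"
  define B where "B = A \<inter> {c..x}"
  let ?S = "\<lambda>x l. {F. set_mset F \<subseteq> A \<and> sum_mset F = x \<and> size F = l}"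
  have nonneg: "sum_mset F \<ge> 0" if "set_mset F \<subseteq> A" for F
    using that pos by (induction F) (auto simp: less_imp_le)
  show ?case
  proof (cases "x > 0")
    case True
    then have "c > 0" by (simp add: c_def del: of_nat_Suc)
    then have "finite B" unfolding B_def by (rule fin)
    moreover have "?S x (Suc l) \<subseteq> (\<Union>a\<in>B. add_mset a ` ?S (x - a) l)"
    proof
      fix F assume "F \<in> ?S x (Suc l)"
      then have F: "set_mset F \<subseteq> A" "sum_mset F = x" "size F = Suc l" by auto
      have "\<exists>a\<in>#F. c \<le> a"
      proof (rule ccontr)
        assume *: "\<not> (\<exists>a\<in>#F. c \<le> a)"
        \<comment> \<open>The bound for \<open>G\<close> is not strict; the single element
          \<open>a < c\<close> supplies the strict inequality.\<close>
        from F(3) obtain a G where G: "F = add_mset a G" by (cases F) auto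
        have "sum_mset G \<le> of_nat (size G) * c"
          using * G by (intro sum_mset_le_size_mult) (auto simp: not_le)
        moreover have "a < c" using * G by auto
        ultimately have "x < of_nat (Suc l) * c"
          using F G by (auto simp: algebra_simps)
        then show False by (simp add: c_def del: of_nat_Suc)
      qed
      then obtain a where a: "a \<in># F" "c \<le> a" by blast
      then obtain G where G: "F = add_mset a G" by (metis mset_add)
      have "a \<in> B" using F G a nonneg[of G] by (auto simp: B_def)
      moreover have "G \<in> ?S (x - a) l" using F G by auto
      ultimately show "F \<in> (\<Union>a\<in>B. add_mset a ` ?S (x - a) l)" using G by blast
    qed
    ultimately show ?thesis
      using Suc.IH by (meson finite_UN_I finite_imageI finite_subset)
  next
    case False
    have "F \<notin> ?S x (Suc l)" for F
    proof
      assume F: "F \<in> ?S x (Suc l)"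
      then obtain a G where G: "F = add_mset a G" by (cases F) auto
      with F have "a > 0" "sum_mset G \<ge> 0" "a + sum_mset G = x"
        using pos nonneg by auto
      with False show False by auto
    qed
    then have "?S x (Suc l) = {}" by blast
    then show ?thesis by (simp only: finite.emptyI)
  qed
qed

text \<open>The finiteness clause of \<open>LFFM\<close> holds for every \<open>q > 0\<close>,
  because all atoms are powers of \<open>q\<close>.\<close>

lemma LFFM_iff_atomic_nat_eval_semiring:
  assumes "q > 0"
  shows "LFFM (nat_eval_semiring q) \<longleftrightarrow> atomic_monoid (nat_eval_semiring q)"
proof -
  let ?A = "add_atoms (nat_eval_semiring q)"
  have "finite {F. set_mset F \<subseteq> ?A \<and> sum_mset F = x \<and> size F = l}" for x l
  proof (rule finite_fixed_size_mset_sum)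
    show "a > 0" if "a \<in> ?A" for a
      using that add_atoms_subset_powers[OF assms] assms by auto
    show "finite (?A \<inter> {c..d})" if "c > 0" for c d
      using finite_powers_Icc[OF assms that, of d]
      by (rule finite_subset[rotated]) (use add_atoms_subset_powers[OF assms] in auto)
  qed
  then show ?thesis
    by (simp add: LFFM_def factorizations_def conj_assoc)
qed

section \<open>Atomicity for \<open>q \<ge> 1\<close>\<close>

lemma atomic_nat_eval_semiring_ge_1:
  assumes "q \<ge> 1"
  shows "atomic_monoid (nat_eval_semiring q)"
proof -
  let ?M = "nat_eval_semiring q"
  have q: "q > 0" using assms by simp
  have ge_1: "x \<ge> 1" if x: "x \<in> ?M" "x \<noteq> 0" for x
  proof -
    obtain ns where ns: "x = (\<Sum>n\<in>#ns. q ^ n)"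
      using x(1) by (auto simp: nat_eval_semiring_eq_sum_powers[OF q])
    with x(2) obtain n ms where "ns = add_mset n ms" by (cases ns) auto
    moreover have "(\<Sum>n\<in>#ms. q ^ n) \<in> ?M"
      by (simp add: nat_eval_semiring_eq_sum_powers[OF q])
    then have "(\<Sum>n\<in>#ms. q ^ n) \<ge> 0" by (rule nat_eval_semiring_nonneg[OF q])
    moreover have "q ^ n \<ge> 1" using assms by simp
    ultimately show ?thesis using ns by simp
  qed
  \<comment> \<open>Induction on an integer bound \<open>k\<close>: each summand of \<open>x\<close>
    is at most \<open>x - 1\<close>, because the other is at least 1.\<close>
  have "\<exists>F. set_mset F \<subseteq> add_atoms ?M \<and> sum_mset F = x"
    if "x \<in> ?M" "x \<noteq> 0" "x \<le> of_nat k" for x k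
    using that
  proof (induction k arbitrary: x)
    case 0
    then show ?case using ge_1[of x] by simp
  next
    case (Suc k)
    show ?case
    proof (cases "x \<in> add_atoms ?M")
      case True
      then show ?thesis by (intro exI[of _ "{#x#}"]) simp
    next
      case False
      with Suc.prems obtain b c where bc: "b \<in> ?M" "c \<in> ?M" "x = b + c" "b \<noteq> 0" "c \<noteq> 0"
        by (auto simp: add_atoms_def)
      then have "b \<ge> 1" "c \<ge> 1" using ge_1 by auto
      with bc Suc.prems have "b \<le> of_nat k" "c \<le> of_nat k" by auto
      with bc Suc.IH obtain F G where "set_mset F \<subseteq> add_atoms ?M" "sum_mset F = b"
        "set_mset G \<subseteq> add_atoms ?M" "sum_mset G = c" by metis
      with bc show ?thesis by (intro exI[of _ "F + G"]) auto
    qed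
  qed
  then show ?thesis
    unfolding atomic_monoid_def by (metis Diff_iff real_arch_simple singleton_iff)
qed

section \<open>Atomicity for \<open>q < 1\<close> with numerator at least 2\<close>

text \<open>Each \<open>q ^ n\<close> with \<open>n > k\<close> has a numerator divisible by
  \<open>a ^ Suc k\<close>, and a common denominator preserves this. Any exponent \<open>N\<close>
  will do, so exponents are simply added.\<close>

lemma sum_higher_powers_clear_denominators:
  fixes a b :: int and q :: rat
  assumes "b \<noteq> 0" "q = of_int a / of_int b" "\<And>n. n \<in># ns \<Longrightarrow> n > k"
  shows "\<exists>N t. (\<Sum>n\<in>#ns. q ^ n) * of_int b ^ N = of_int (a ^ Suc k * t)"
  using assms(3)
proof (induction ns)
  case empty
  show ?case by (intro exI[of _ 0]) simp
next
  case (add n ns)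
  then obtain N t where IH: "(\<Sum>n\<in>#ns. q ^ n) * of_int b ^ N = of_int (a ^ Suc k * t)"
    by auto
  have "Suc k \<le> n" using add.prems by (simp add: Suc_le_eq)
  then obtain m where n: "n = Suc k + m" using le_Suc_ex by blast
  have qn: "q ^ n * of_int b ^ n = of_int (a ^ n)"
    using assms(1,2) by (simp add: power_divide)
  then have "(q ^ n + (\<Sum>n\<in>#ns. q ^ n)) * of_int b ^ (N + n)
      = of_int (a ^ n) * of_int b ^ N + of_int (a ^ Suc k * t) * of_int b ^ n"
    by (simp only: IH[symmetric] flip: qn) (simp add: algebra_simps power_add)
  also have "\<dots> = of_int (a ^ Suc k * (a ^ m * b ^ N + t * b ^ n))"
    by (simp only: n power_add of_int_mult of_int_add of_int_power distrib_left mult.assoc)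
  finally have "(\<Sum>n\<in>#add_mset n ns. q ^ n) * of_int b ^ (N + n)
      = of_int (a ^ Suc k * (a ^ m * b ^ N + t * b ^ n))" by simp
  then show ?case by blast
qed

lemma power_add_atom_less_1:
  fixes a b :: int
  assumes q: "0 < q" "q < 1" "q = of_int a / of_int b" and ab: "a \<ge> 2" "b > 0" "coprime a b"
  shows "q ^ k \<in> add_atoms (nat_eval_semiring q)"
proof -
  let ?M = "nat_eval_semiring q"
  have False if bc: "u \<in> ?M" "v \<in> ?M" "q ^ k = u + v" "u \<noteq> 0" "v \<noteq> 0" for u v
  proof -
    obtain ms ns where sums: "u = (\<Sum>n\<in>#ms. q ^ n)" "v = (\<Sum>n\<in>#ns. q ^ n)"
      using bc by (auto simp: nat_eval_semiring_eq_sum_powers[OF q(1)])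
    have "u > 0" "v > 0"
      using bc nat_eval_semiring_nonneg[OF q(1)] by (auto simp: order_less_le)
    \<comment> \<open>Powers decrease in the exponent, so an exponent at most \<open>k\<close> would
      already make the sum at least \<open>q ^ k\<close>.\<close>
    have higher: "n > k" if n: "n \<in># ls" and less: "(\<Sum>n\<in>#ls. q ^ n) < q ^ k" for n ls
    proof (rule ccontr)
      assume "\<not> n > k"
      then have "q ^ k \<le> q ^ n" using q by (intro power_decreasing) auto
      moreover obtain js where js: "ls = add_mset n js" using n by (metis mset_add)
      moreover have "(\<Sum>n\<in>#js. q ^ n) \<in> ?M"
        by (simp add: nat_eval_semiring_eq_sum_powers[OF q(1)])
      then have "(\<Sum>n\<in>#js. q ^ n) \<ge> 0" by (rule nat_eval_semiring_nonneg[OF q(1)])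
      ultimately show False using less by simp
    qed
    have "n > k" if "n \<in># ms + ns" for n
      using that higher[of n ms] higher[of n ns] sums bc(3) \<open>u > 0\<close> \<open>v > 0\<close> by auto
    then obtain N t where "(\<Sum>n\<in>#ms + ns. q ^ n) * of_int b ^ N = of_int (a ^ Suc k * t)"
      using sum_higher_powers_clear_denominators[of b q a "ms + ns" k] q ab by blast
    then have "q ^ k * of_int b ^ N = of_int (a ^ Suc k * t)"
      using sums bc(3) by simp
    moreover have "q ^ k * of_int b ^ k = of_int (a ^ k)"
      using q(3) ab by (simp add: power_divide)
    \<comment> \<open>Both sides equal \<open>q ^ k * b ^ (N + k)\<close>. Cancelling
      \<open>a ^ k\<close> leaves one factor \<open>a\<close> on the right only.\<close>
    ultimately have "of_int (a ^ k * b ^ N) = (of_int (a ^ Suc k * t * b ^ k) :: rat)"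
      by (metis (no_types, opaque_lifting) mult.assoc mult.commute of_int_mult of_int_power)
    then have "a ^ k * b ^ N = a ^ Suc k * t * b ^ k" by (simp only: of_int_eq_iff)
    then have "a ^ k * b ^ N = a ^ k * (a * (t * b ^ k))" by (simp add: ac_simps)
    then have "b ^ N = a * (t * b ^ k)" using ab by simp
    then have "a dvd b ^ N" by simp
    moreover have "coprime a (b ^ N)" using ab by simp
    ultimately have "is_unit a" by (metis coprime_absorb_left)
    then show False using ab by simp
  qed
  then show ?thesis
    using power_in_nat_eval_semiring[OF q(1), of k] q(1) unfolding add_atoms_def by auto
qed

text \<open>In lowest terms, the excluded reciprocals are the case of numerator 1. Otherwise all
  powers are atoms, so every sum of powers is already a factorization.\<close>

lemma atomic_nat_eval_semiring_less_1:
  assumes "0 < q" "q < 1" "q \<notin> {1 / of_nat n | n :: nat. n \<ge> 2}"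
  shows "atomic_monoid (nat_eval_semiring q)"
proof -
  obtain a b where "q = Fract a b" "b > 0" "coprime a b" by (cases q)
  then have ab: "q = of_int a / of_int b" "b > 0" "coprime a b" by (auto simp: Fract_of_int_quotient)
  have "a > 0" using ab assms(1) by (simp add: zero_less_divide_iff)
  moreover have "a \<noteq> 1"
  proof
    assume "a = 1"
    with ab assms(2) have "b \<ge> 2" by (cases "b = 1") auto
    then have "q = 1 / of_nat (nat b)" "nat b \<ge> 2" using ab \<open>a = 1\<close> by auto
    with assms(3) show False by blast
  qed
  ultimately have "a \<ge> 2" by simp
  then have atom: "q ^ k \<in> add_atoms (nat_eval_semiring q)" for k
    using power_add_atom_less_1 assms ab by blast
  show ?thesis
    unfolding atomic_monoid_def
  proof
    fix x assume "x \<in> nat_eval_semiring q - {0}"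
    then obtain ns where ns: "x = (\<Sum>n\<in>#ns. q ^ n)"
      by (auto simp: nat_eval_semiring_eq_sum_powers[OF assms(1)])
    have "set_mset (image_mset (\<lambda>n. q ^ n) ns) \<subseteq> add_atoms (nat_eval_semiring q)"
      using atom by auto
    with ns show "\<exists>F. set_mset F \<subseteq> add_atoms (nat_eval_semiring q) \<and> sum_mset F = x"
      by blast
  qed
qed

section \<open>Failure of atomicity for reciprocals of integers\<close>

lemma not_atomic_nat_eval_semiring_inverse_nat:
  assumes "n \<ge> 2"
  shows "\<not> atomic_monoid (nat_eval_semiring (1 / of_nat n))"
proof
  define q :: rat where "q = 1 / of_nat n"
  let ?M = "nat_eval_semiring q"
  have q: "q > 0" using assms by (simp add: q_def)
  assume "atomic_monoid (nat_eval_semiring (1 / of_nat n))"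
  then have "atomic_monoid ?M" by (simp add: q_def)
  \<comment> \<open>A factorization of 1 is nonempty, so it would provide an atom.\<close>
  moreover have "1 \<in> ?M - {0}" using power_in_nat_eval_semiring[OF q, of 0] by simp
  ultimately obtain F where F: "set_mset F \<subseteq> add_atoms ?M" "sum_mset F = 1"
    unfolding atomic_monoid_def by blast
  then obtain a where "a \<in># F" by (cases F) auto
  with F have a: "a \<in> add_atoms ?M" by blast
  then obtain k where k: "a = q ^ k" using add_atoms_subset_powers[OF q] by blast
  \<comment> \<open>Of the \<open>n\<close> copies of \<open>q ^ Suc k\<close> making up
    \<open>a\<close>, one is split off; the other \<open>n - 1 \<ge> 1\<close> form a nonzero
    summand.\<close>
  have "(\<Sum>i\<in>#replicate_mset (n - 1) (Suc k). q ^ i) \<in> ?M"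
    unfolding nat_eval_semiring_eq_sum_powers[OF q] by (rule rangeI)
  then have "of_nat (n - 1) * q ^ Suc k \<in> ?M"
    unfolding image_replicate_mset sum_mset_replicate_mset .
  moreover have "q ^ Suc k \<in> ?M" by (rule power_in_nat_eval_semiring[OF q])
  moreover have "a = q ^ Suc k + of_nat (n - 1) * q ^ Suc k"
    using assms by (simp add: k q_def of_nat_diff field_simps)
  ultimately have "q ^ Suc k = 0 \<or> of_nat (n - 1) * q ^ Suc k = 0"
    using a unfolding add_atoms_def by blast
  then show False using q assms by simp
qed

theorem theorem6p2:
  fixes q :: rat
  assumes "q > 0"
  shows "(LFFM (nat_eval_semiring q) \<longleftrightarrow> atomic_monoid (nat_eval_semiring q)) \<and>
         (atomic_monoid (nat_eval_semiring q) \<longleftrightarrow> q \<notin> {1 / of_nat n | n :: nat. n \<ge> 2})"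
  using LFFM_iff_atomic_nat_eval_semiring[OF assms] atomic_nat_eval_semiring_ge_1[of q]
    atomic_nat_eval_semiring_less_1[OF assms] not_atomic_nat_eval_semiring_inverse_nat
  by (cases "q < 1") auto

end
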